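(* Given a preDSC $(E,\mathrm{dep})$, its reachable dependency poset $\mathsf{rdp}(E)$ is a finite join-semilattice.
   Context: $P(A)$ denotes the power set of $A$. A preDSC is a pair $(E,\mathrm{dep})$ with $E$ a finite set and $\mathrm{dep}:E\to P(P(E))$ a function. For $X,Y\subseteq E$ write $X\,\mathrm{rch}\,Y$ if $X\subseteq Y$ and for every $y\in Y$ there is $D\in\mathrm{dep}(y)$ with $D\subseteq X$. A subset $X\subseteq E$ is reachable if there is a finite sequence of subsets $X_0,\dots,X_n$ of $E$ with $\varnothing\,\mathrm{rch}\,X_0\,\mathrm{rch}\cdots\mathrm{rch}\,X_n\,\mathrm{rch}\,X$. $\mathsf{rdp}(E)$ is the poset of reachable subsets of $E$ ordered by inclusion. A join-semilattice is a poset in which every two elements have a join (least upper bound). *)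

theory Defs
  imports "HOL-Algebra.Lattice"
begin

text \<open>
  The function \<open>dep\<close> is total on the type \<open>'a\<close>; its values outside \<open>E\<close> are
  unconstrained and play no role below, since it is applied to elements of subsets of \<open>E\<close> only.
\<close>

locale preDSC =
  fixes E :: "'a set" and dep :: "'a \<Rightarrow> 'a set set"
  assumes finite_carrier: "finite E"
    and dep_funcset: "dep \<in> E \<rightarrow> Pow (Pow E)"

definition rch :: "'a set \<Rightarrow> ('a \<Rightarrow> 'a set set) \<Rightarrow> 'a set \<Rightarrow> 'a set \<Rightarrow> bool" where
  "rch E dep X Y \<longleftrightarrow>
     X \<subseteq> E \<and> Y \<subseteq> E \<and> X \<subseteq> Y \<and> (\<forall>y\<in>Y. \<exists>D\<in>dep y. D \<subseteq> X)"

definition reachable :: "'a set \<Rightarrow> ('a \<Rightarrow> 'a set set) \<Rightarrow> 'a set \<Rightarrow> bool" where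
  "reachable E dep X \<longleftrightarrow> X \<subseteq> E \<and>
     (\<exists>(n::nat) (S::nat \<Rightarrow> 'a set).
        (\<forall>i\<le>n. S i \<subseteq> E) \<and>
        rch E dep {} (S 0) \<and>
        (\<forall>i<n. rch E dep (S i) (S (Suc i))) \<and>
        rch E dep (S n) X)"

definition rdp :: "'a set \<Rightarrow> ('a \<Rightarrow> 'a set set) \<Rightarrow> 'a set gorder" where
  "rdp E dep = \<lparr>carrier = {X. reachable E dep X}, eq = (=), le = (\<subseteq>)\<rparr>"

end

theory Submission
  imports Defs
begin

text \<open>
  The join of two reachable sets is their union, so everything reduces to closure of the
  reachable sets under union. Two chains of reachability steps cannot simply be united term by
  term, since they may differ in length. Instead they are run one after the other: first
  build \<open>A\<close>, then replay the chain of \<open>B\<close> with \<open>A\<close> added to every term. The replay is again a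
  chain because a reachable set supports itself, that is, \<open>rch\<close> relates it to itself: its
  elements depend on a subset of the preceding term, which the set contains. So the single
  set \<open>A\<close> can be carried along at each step (\<open>reachable_Un\<close>).
\<close>

text \<open>
  The definition of reachability asks for at least two steps, but a chain can be lengthened at
  its start by steps from \<open>{}\<close> to itself. This turns reachability into a reflexive transitive closure,
  for which rule induction is available.
\<close>

lemma reachable_iff_rtranclp: "reachable E dep X \<longleftrightarrow> (rch E dep)\<^sup>*\<^sup>* {} X"
proof
  assume "reachable E dep X"
  then obtain n S where S: "rch E dep {} (S 0)" "\<forall>i<n. rch E dep (S i) (S (Suc i))"
    "rch E dep (S n) X"
    unfolding reachable_def by blast
  have "i \<le> n \<Longrightarrow> (rch E dep)\<^sup>*\<^sup>* {} (S i)" for i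
  proof (induction i)
    case 0
    then show ?case using S(1) by blast
  next
    case (Suc i)
    then show ?case using S(2) by (meson Suc_le_lessD less_imp_le rtranclp.rtrancl_into_rtrancl)
  qed
  then show "(rch E dep)\<^sup>*\<^sup>* {} X"
    using S(3) by (meson order_refl rtranclp.rtrancl_into_rtrancl)
next
  assume "(rch E dep)\<^sup>*\<^sup>* {} X"
  then show "reachable E dep X"
  proof (induction rule: rtranclp_induct)
    case base
    show ?case
      unfolding reachable_def
      by (rule conjI, simp, rule exI[of _ 0], rule exI[of _ "\<lambda>_. {}"]) (simp add: rch_def)
  next
    case (step X Y)
    then obtain n S where S: "\<forall>i\<le>n. S i \<subseteq> E" "rch E dep {} (S 0)"
      "\<forall>i<n. rch E dep (S i) (S (Suc i))" "rch E dep (S n) X"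
      unfolding reachable_def by blast
    have "X \<subseteq> E" "Y \<subseteq> E"
      using step.hyps(2) by (auto simp: rch_def)
    moreover define T where "T = S(Suc n := X)"
    moreover have "\<forall>i\<le>Suc n. T i \<subseteq> E" "rch E dep {} (T 0)" "rch E dep (T (Suc n)) Y"
      "\<forall>i<Suc n. rch E dep (T i) (T (Suc i))"
      using S step.hyps(2) \<open>X \<subseteq> E\<close> by (auto simp: T_def less_Suc_eq le_Suc_eq)
    ultimately show ?case
      unfolding reachable_def by blast
  qed
qed

lemma reachable_self_rch:
  assumes "reachable E dep X"
  shows "rch E dep X X"
proof -
  obtain W where "rch E dep W X"
    using assms unfolding reachable_def by blast
  then show ?thesis
    unfolding rch_def by (meson order_refl order_trans)
qed

lemma rch_Un:
  assumes "rch E dep X Y" and "rch E dep X' Y'"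
  shows "rch E dep (X \<union> X') (Y \<union> Y')"
  using assms unfolding rch_def by (auto; meson le_supI1 le_supI2)

lemma reachable_Un:
  assumes A: "reachable E dep A" and B: "reachable E dep B"
  shows "reachable E dep (A \<union> B)"
proof -
  have "(rch E dep)\<^sup>*\<^sup>* {} B"
    using B by (simp add: reachable_iff_rtranclp)
  then have "(rch E dep)\<^sup>*\<^sup>* {} (A \<union> B)"
  proof (induction rule: rtranclp_induct)
    case base
    then show ?case using A by (simp add: reachable_iff_rtranclp)
  next
    case (step X Y)
    then show ?case
      using rch_Un[OF reachable_self_rch[OF A]] by (meson rtranclp.rtrancl_into_rtrancl)
  qed
  then show ?thesis by (simp add: reachable_iff_rtranclp)
qed

lemma partial_order_rdp: "partial_order (rdp E dep)"
  by unfold_locales (auto simp: rdp_def)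

theorem corollary2p10:
  fixes E :: "'a set" and dep :: "'a \<Rightarrow> 'a set set"
  assumes "preDSC E dep"
  shows "finite (carrier (rdp E dep)) \<and> upper_semilattice (rdp E dep)"
proof
  have "finite E"
    using assms by (rule preDSC.finite_carrier)
  moreover have "carrier (rdp E dep) \<subseteq> Pow E"
    by (auto simp: rdp_def reachable_def)
  ultimately show "finite (carrier (rdp E dep))"
    by (meson finite_Pow_iff finite_subset)
next
  interpret partial_order "rdp E dep" by (rule partial_order_rdp)
  show "upper_semilattice (rdp E dep)"
  proof
    fix A B
    assume "A \<in> carrier (rdp E dep)" "B \<in> carrier (rdp E dep)"
    then have "least (rdp E dep) (A \<union> B) (Upper (rdp E dep) {A, B})"
      using reachable_Un[of E dep A B] by (auto simp: rdp_def least_def Upper_def)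
    then show "\<exists>s. least (rdp E dep) s (Upper (rdp E dep) {A, B})" ..
  qed
qed

end
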